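(* Let $\mathscr{C}$ be a finite fuzzy covering on $\mathbb{U}$, let $O$ be an overlap function satisfying (O7) and let $I_O$ be its $R_O$-implicator. With the groups of operators $A1,\dots,M$ described in the context, where for groups $P\le Q$ means that $N\le N'$ for every operator $N$ in $P$ and $N'$ in $Q$ (all operators in one group are equal): (1) for $\mathscr{C}$: $A1\le F1$ and $E\le H1$ (i.e. $N_1^{\mathscr{C}}\le N_3^{\mathscr{C}}$, $N_2^{\mathscr{C}}\le N_4^{\mathscr{C}}$); (2) for $\mathscr{C}_1$: $A1\le B$ and $E\le L$ (i.e. $N_1^{\mathscr{C}_1}\le N_3^{\mathscr{C}_1}$, $N_2^{\mathscr{C}_1}\le N_4^{\mathscr{C}_1}$); (3) for $\mathscr{C}_2$: $F2\le F1$ and $H2\le H1$ (i.e. $N_1^{\mathscr{C}_2}\le N_3^{\mathscr{C}_2}$, $N_2^{\mathscr{C}_2}\le N_4^{\mathscr{C}_2}$); (4) for $\mathscr{C}_3$: $A3\le C$ and $A2\le D$ (i.e. $N_1^{\mathscr{C}_3}\le N_3^{\mathscr{C}_3}$, $N_2^{\mathscr{C}_3}\le N_4^{\mathscr{C}_3}$); (5) for $\mathscr{C}_4$: $I\le K$ and $G\le J$ (i.e. $N_2^{\mathscr{C}_4}\le N_4^{\mathscr{C}_4}$, $N_1^{\mathscr{C}_4}\le N_3^{\mathscr{C}_4}$); (6) for $\mathscr{C}_\cap$: $M\le H1$ and $A1\le F1$ (i.e. $N_2^{\mathscr{C}_\cap}\le N_4^{\mathscr{C}_\cap}$, $N_1^{\mathscr{C}_\cap}\le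 N_3^{\mathscr{C}_\cap}$).
   Context: $\mathbb{U}$ is a non-empty set; fuzzy subsets of $\mathbb{U}$ are maps $\mathbb{U}\to[0,1]$; inclusion is pointwise $\le$ and intersection is the pointwise infimum. Infima and suprema are taken in $[0,1]$ ($\inf\emptyset=1$, $\sup\emptyset=0$). A fuzzy covering on $\mathbb{U}$ is a collection $\mathscr{C}$ of fuzzy subsets of $\mathbb{U}$, none identically $0$, such that for every $x\in\mathbb{U}$ there is $K\in\mathscr{C}$ with $K(x)=1$. An overlap function is a map $O:[0,1]^2\to[0,1]$ that is commutative, increasing (non-decreasing in each argument), continuous, and satisfies $O(x,y)=0\iff xy=0$ and $O(x,y)=1\iff xy=1$. Condition (O7): $O(x,1)\le x$ for all $x\in[0,1]$. The $R_O$-implicator of $O$ is $I_O(x,y)=\max\{z\in[0,1]:O(x,z)\le y\}$. For a collection $\mathscr{D}$ of fuzzy sets and $x,y\in\mathbb{U}$: $\mathbb{C}(\mathscr{D},x)=\{K\in\mathscr{D}:K(x)>0\}$; $md(\mathscr{D},x)=\{K\in\mathbb{C}(\mathscr{D},x):\forall S\in\mathbb{C}(\mathscr{D},x),\ (S(x)=K(x)\text{ and }S\subseteq K)\Rightarrow S=K\}$; $MD(\mathscr{D},x)=\{K\in\mathbb{C}(\mathscr{D},x):\forall S\in\mathbb{C}(\mathscr{D},x),\ (S(x)=K(x)\text{ and }S\supseteq K)\Rightarrow S=K\}$; $N_1^{\mathscr{D}}(x)(y)=\inf_{K\in\mathscr{D}}I_O(K(x),K(y))$, $N_2^{\mathscr{D}}(x)(y)=\sup_{K\in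 md(\mathscr{D},x)}O(K(x),K(y))$, $N_3^{\mathscr{D}}(x)(y)=\inf_{K\in MD(\mathscr{D},x)}I_O(K(x),K(y))$, $N_4^{\mathscr{D}}(x)(y)=\sup_{K\in\mathscr{D}}O(K(x),K(y))$. Derived coverings: $\mathscr{C}_1=\bigcup_{x\in\mathbb{U}}md(\mathscr{C},x)$; $\mathscr{C}_2=\bigcup_{x\in\mathbb{U}}MD(\mathscr{C},x)$; $\mathscr{C}_3=\{N_1^{\mathscr{C}}(x):x\in\mathbb{U}\}$; $\mathscr{C}_4=\{N_4^{\mathscr{C}}(x):x\in\mathbb{U}\}$; $\mathscr{C}_\cap=\mathscr{C}\setminus\{K\in\mathscr{C}:\exists\text{ non-empty }\mathscr{C}'\subseteq\mathscr{C}\setminus\{K\}\text{ with }K=\bigcap\mathscr{C}'\}$. Groups: $A1=\{N_1^{\mathscr{C}},N_1^{\mathscr{C}_1},N_1^{\mathscr{C}_\cap}\}$, $A2=\{N_2^{\mathscr{C}_3}\}$, $A3=\{N_1^{\mathscr{C}_3}\}$, $B=\{N_3^{\mathscr{C}_1}\}$, $C=\{N_3^{\mathscr{C}_3}\}$, $D=\{N_4^{\mathscr{C}_3}\}$, $E=\{N_2^{\mathscr{C}},N_2^{\mathscr{C}_1}\}$, $F1=\{N_3^{\mathscr{C}},N_3^{\mathscr{C}_2},N_3^{\mathscr{C}_\cap}\}$, $F2=\{N_1^{\mathscr{C}_2}\}$, $G=\{N_1^{\mathscr{C}_4}\}$, $H1=\{N_4^{\mathscr{C}},N_4^{\mathscr{C}_2},N_4^{\mathscr{C}_\cap}\}$,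 $H2=\{N_2^{\mathscr{C}_2}\}$, $I=\{N_2^{\mathscr{C}_4}\}$, $J=\{N_3^{\mathscr{C}_4}\}$, $K=\{N_4^{\mathscr{C}_4}\}$, $L=\{N_4^{\mathscr{C}_1}\}$, $M=\{N_2^{\mathscr{C}_\cap}\}$. For operators, $N\le N'$ means $N(x)(y)\le N'(x)(y)$ for all $x,y\in\mathbb{U}$. *)

theory Defs
  imports "HOL-Analysis.Analysis"
begin

text \<open>The universe is the type \<open>'u\<close>, which is non-empty like every HOL type. Fuzzy subsets are
  functions into the reals with values in \<open>{0..1}\<close>; their inclusion, and the comparison of
  neighborhood operators, is the library's pointwise order \<open>\<le>\<close> on functions.\<close>

type_synonym 'u fuzzy = "'u \<Rightarrow> real"

type_synonym 'u nbh_op = "'u \<Rightarrow> 'u fuzzy"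

text \<open>Infimum and supremum in the lattice \<open>[0,1]\<close>: the library's \<open>Inf {}\<close> and \<open>Sup {}\<close> on the reals
  are not the bounds 1 and 0.\<close>

definition inf01 :: "real set \<Rightarrow> real" where
  "inf01 S = (if S = {} then 1 else Inf S)"

definition sup01 :: "real set \<Rightarrow> real" where
  "sup01 S = (if S = {} then 0 else Sup S)"

definition fuzzy_Inter :: "'u fuzzy set \<Rightarrow> 'u fuzzy" where
  "fuzzy_Inter D = (\<lambda>x. inf01 ((\<lambda>K. K x) ` D))"

definition fuzzy_covering :: "'u fuzzy set \<Rightarrow> bool" where
  "fuzzy_covering C \<longleftrightarrow>
     (\<forall>K\<in>C. \<forall>x. K x \<in> {0..1}) \<and>
     (\<forall>K\<in>C. \<exists>x. K x \<noteq> 0) \<and>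
     (\<forall>x. \<exists>K\<in>C. K x = 1)"

definition overlap_function :: "(real \<Rightarrow> real \<Rightarrow> real) \<Rightarrow> bool" where
  "overlap_function Ov \<longleftrightarrow>
     (\<forall>x\<in>{0..1}. \<forall>y\<in>{0..1}. Ov x y \<in> {0..1}) \<and>
     (\<forall>x\<in>{0..1}. \<forall>y\<in>{0..1}. Ov x y = Ov y x) \<and>
     (\<forall>x\<in>{0..1}. \<forall>y\<in>{0..1}. Ov x y = 0 \<longleftrightarrow> x * y = 0) \<and>
     (\<forall>x\<in>{0..1}. \<forall>y\<in>{0..1}. Ov x y = 1 \<longleftrightarrow> x * y = 1) \<and>
     (\<forall>x\<in>{0..1}. \<forall>x'\<in>{0..1}. \<forall>y\<in>{0..1}. \<forall>y'\<in>{0..1}.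
        x \<le> x' \<longrightarrow> y \<le> y' \<longrightarrow> Ov x y \<le> Ov x' y') \<and>
     continuous_on ({0..1} \<times> {0..1}) (\<lambda>(x, y). Ov x y)"

definition overlap_O7 :: "(real \<Rightarrow> real \<Rightarrow> real) \<Rightarrow> bool" where
  "overlap_O7 Ov \<longleftrightarrow> (\<forall>x\<in>{0..1}. Ov x 1 \<le> x)"

text \<open>For an overlap function and arguments in \<open>[0,1]\<close> the maximum exists, by continuity and
  because \<open>z = 0\<close> is always admissible.\<close>

definition R_implicator :: "(real \<Rightarrow> real \<Rightarrow> real) \<Rightarrow> real \<Rightarrow> real \<Rightarrow> real" where
  "R_implicator Ov x y = (GREATEST z. z \<in> {0..1} \<and> Ov x z \<le> y)"

definition members_at :: "'u fuzzy set \<Rightarrow> 'u \<Rightarrow> 'u fuzzy set" where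
  "members_at D x = {K \<in> D. K x > 0}"

definition md :: "'u fuzzy set \<Rightarrow> 'u \<Rightarrow> 'u fuzzy set" where
  "md D x = {K \<in> members_at D x. \<forall>S \<in> members_at D x. S x = K x \<and> S \<le> K \<longrightarrow> S = K}"

definition MD :: "'u fuzzy set \<Rightarrow> 'u \<Rightarrow> 'u fuzzy set" where
  "MD D x = {K \<in> members_at D x. \<forall>S \<in> members_at D x. S x = K x \<and> S \<ge> K \<longrightarrow> S = K}"

definition N1 :: "(real \<Rightarrow> real \<Rightarrow> real) \<Rightarrow> 'u fuzzy set \<Rightarrow> 'u nbh_op" where
  "N1 Ov D x y = inf01 ((\<lambda>K. R_implicator Ov (K x) (K y)) ` D)"

definition N2 :: "(real \<Rightarrow> real \<Rightarrow> real) \<Rightarrow> 'u fuzzy set \<Rightarrow> 'u nbh_op" where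
  "N2 Ov D x y = sup01 ((\<lambda>K. Ov (K x) (K y)) ` md D x)"

definition N3 :: "(real \<Rightarrow> real \<Rightarrow> real) \<Rightarrow> 'u fuzzy set \<Rightarrow> 'u nbh_op" where
  "N3 Ov D x y = inf01 ((\<lambda>K. R_implicator Ov (K x) (K y)) ` MD D x)"

definition N4 :: "(real \<Rightarrow> real \<Rightarrow> real) \<Rightarrow> 'u fuzzy set \<Rightarrow> 'u nbh_op" where
  "N4 Ov D x y = sup01 ((\<lambda>K. Ov (K x) (K y)) ` D)"

definition cov1 :: "'u fuzzy set \<Rightarrow> 'u fuzzy set" where
  "cov1 C = (\<Union>x. md C x)"

definition cov2 :: "'u fuzzy set \<Rightarrow> 'u fuzzy set" where
  "cov2 C = (\<Union>x. MD C x)"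

definition cov3 :: "(real \<Rightarrow> real \<Rightarrow> real) \<Rightarrow> 'u fuzzy set \<Rightarrow> 'u fuzzy set" where
  "cov3 Ov C = range (N1 Ov C)"

definition cov4 :: "(real \<Rightarrow> real \<Rightarrow> real) \<Rightarrow> 'u fuzzy set \<Rightarrow> 'u fuzzy set" where
  "cov4 Ov C = range (N4 Ov C)"

definition cov_Int :: "'u fuzzy set \<Rightarrow> 'u fuzzy set" where
  "cov_Int C = C - {K \<in> C. \<exists>C'. C' \<noteq> {} \<and> C' \<subseteq> C - {K} \<and> K = fuzzy_Inter C'}"

definition group_A1 :: "(real \<Rightarrow> real \<Rightarrow> real) \<Rightarrow> 'u fuzzy set \<Rightarrow> 'u nbh_op set" where
  "group_A1 Ov C = {N1 Ov C, N1 Ov (cov1 C), N1 Ov (cov_Int C)}"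

definition group_A2 :: "(real \<Rightarrow> real \<Rightarrow> real) \<Rightarrow> 'u fuzzy set \<Rightarrow> 'u nbh_op set" where
  "group_A2 Ov C = {N2 Ov (cov3 Ov C)}"

definition group_A3 :: "(real \<Rightarrow> real \<Rightarrow> real) \<Rightarrow> 'u fuzzy set \<Rightarrow> 'u nbh_op set" where
  "group_A3 Ov C = {N1 Ov (cov3 Ov C)}"

definition group_B :: "(real \<Rightarrow> real \<Rightarrow> real) \<Rightarrow> 'u fuzzy set \<Rightarrow> 'u nbh_op set" where
  "group_B Ov C = {N3 Ov (cov1 C)}"

definition group_C :: "(real \<Rightarrow> real \<Rightarrow> real) \<Rightarrow> 'u fuzzy set \<Rightarrow> 'u nbh_op set" where
  "group_C Ov C = {N3 Ov (cov3 Ov C)}"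

definition group_D :: "(real \<Rightarrow> real \<Rightarrow> real) \<Rightarrow> 'u fuzzy set \<Rightarrow> 'u nbh_op set" where
  "group_D Ov C = {N4 Ov (cov3 Ov C)}"

definition group_E :: "(real \<Rightarrow> real \<Rightarrow> real) \<Rightarrow> 'u fuzzy set \<Rightarrow> 'u nbh_op set" where
  "group_E Ov C = {N2 Ov C, N2 Ov (cov1 C)}"

definition group_F1 :: "(real \<Rightarrow> real \<Rightarrow> real) \<Rightarrow> 'u fuzzy set \<Rightarrow> 'u nbh_op set" where
  "group_F1 Ov C = {N3 Ov C, N3 Ov (cov2 C), N3 Ov (cov_Int C)}"

definition group_F2 :: "(real \<Rightarrow> real \<Rightarrow> real) \<Rightarrow> 'u fuzzy set \<Rightarrow> 'u nbh_op set" where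
  "group_F2 Ov C = {N1 Ov (cov2 C)}"

definition group_G :: "(real \<Rightarrow> real \<Rightarrow> real) \<Rightarrow> 'u fuzzy set \<Rightarrow> 'u nbh_op set" where
  "group_G Ov C = {N1 Ov (cov4 Ov C)}"

definition group_H1 :: "(real \<Rightarrow> real \<Rightarrow> real) \<Rightarrow> 'u fuzzy set \<Rightarrow> 'u nbh_op set" where
  "group_H1 Ov C = {N4 Ov C, N4 Ov (cov2 C), N4 Ov (cov_Int C)}"

definition group_H2 :: "(real \<Rightarrow> real \<Rightarrow> real) \<Rightarrow> 'u fuzzy set \<Rightarrow> 'u nbh_op set" where
  "group_H2 Ov C = {N2 Ov (cov2 C)}"

definition group_I :: "(real \<Rightarrow> real \<Rightarrow> real) \<Rightarrow> 'u fuzzy set \<Rightarrow> 'u nbh_op set" where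
  "group_I Ov C = {N2 Ov (cov4 Ov C)}"

definition group_J :: "(real \<Rightarrow> real \<Rightarrow> real) \<Rightarrow> 'u fuzzy set \<Rightarrow> 'u nbh_op set" where
  "group_J Ov C = {N3 Ov (cov4 Ov C)}"

definition group_K :: "(real \<Rightarrow> real \<Rightarrow> real) \<Rightarrow> 'u fuzzy set \<Rightarrow> 'u nbh_op set" where
  "group_K Ov C = {N4 Ov (cov4 Ov C)}"

definition group_L :: "(real \<Rightarrow> real \<Rightarrow> real) \<Rightarrow> 'u fuzzy set \<Rightarrow> 'u nbh_op set" where
  "group_L Ov C = {N4 Ov (cov1 C)}"

definition group_M :: "(real \<Rightarrow> real \<Rightarrow> real) \<Rightarrow> 'u fuzzy set \<Rightarrow> 'u nbh_op set" where
  "group_M Ov C = {N2 Ov (cov_Int C)}"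

definition group_le :: "'u nbh_op set \<Rightarrow> 'u nbh_op set \<Rightarrow> bool" (infix "\<preceq>" 50) where
  "P \<preceq> Q \<longleftrightarrow> (\<forall>N\<in>P. \<forall>N'\<in>Q. N \<le> N')"

definition all_equal :: "'u nbh_op set \<Rightarrow> bool" where
  "all_equal P \<longleftrightarrow> (\<forall>N\<in>P. \<forall>N'\<in>P. N = N')"

end

theory Submission imports Defs begin

text \<open>Inside each group the operators agree by domination: since \<open>C\<close> is finite, every \<open>K\<close> in \<open>C\<close> lies
  above a minimal and below a maximal member having the same value at a prescribed point, and the implicator
  is antitone in its first and monotone in its second argument. A reducible \<open>K\<close> is a minimum of
  other members, one of which agrees with \<open>K\<close> at the prescribed point, so members that are maximal
  with a prescribed value are irreducible. The inequalities between groups compare an infimum or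
  supremum over \<open>D\<close> with one over a subset of \<open>D\<close>.\<close>

section \<open>Infima and suprema in the unit interval\<close>

lemma inf01_le:
  assumes "S \<subseteq> {0..1}" "s \<in> S"
  shows "inf01 S \<le> s"
proof -
  have "bdd_below S"
    using assms(1) by (meson bdd_below_Icc bdd_below_mono)
  then show ?thesis
    using assms(2) by (auto simp: inf01_def intro: cInf_lower)
qed

lemma inf01_ge:
  assumes "\<And>s. s \<in> S \<Longrightarrow> b \<le> s" "b \<le> 1"
  shows "b \<le> inf01 S"
  using assms by (auto simp: inf01_def intro: cInf_greatest)

lemma sup01_ge:
  assumes "S \<subseteq> {0..1}" "s \<in> S"
  shows "s \<le> sup01 S"
proof -
  have "bdd_above S"
    using assms(1) by (meson bdd_above_Icc bdd_above_mono)
  then show ?thesis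
    using assms(2) by (auto simp: sup01_def intro: cSup_upper)
qed

lemma sup01_le:
  assumes "\<And>s. s \<in> S \<Longrightarrow> s \<le> b" "0 \<le> b"
  shows "sup01 S \<le> b"
  using assms by (auto simp: sup01_def intro: cSup_least)

lemma inf01_in_unit: "S \<subseteq> {0..1} \<Longrightarrow> inf01 S \<in> {0..1}"
proof (cases "S = {}")
  case False
  assume S: "S \<subseteq> {0..1}"
  from False obtain s where "s \<in> S" by blast
  with S have "inf01 S \<le> 1"
    using inf01_le[OF S] by fastforce
  moreover have "0 \<le> inf01 S"
    using S by (intro inf01_ge) auto
  ultimately show ?thesis by simp
qed (simp add: inf01_def)

lemma sup01_in_unit: "S \<subseteq> {0..1} \<Longrightarrow> sup01 S \<in> {0..1}"
proof (cases "S = {}")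
  case False
  assume S: "S \<subseteq> {0..1}"
  from False obtain s where "s \<in> S" by blast
  with S have "0 \<le> sup01 S"
    using sup01_ge[OF S] by fastforce
  moreover have "sup01 S \<le> 1"
    using S by (intro sup01_le) auto
  ultimately show ?thesis by simp
qed (simp add: sup01_def)

text \<open>The alternative \<open>1 \<le> t\<close> lets an element of \<open>T\<close> do without
  a partner in \<open>S\<close>, since \<open>inf01 S\<close> never exceeds 1. It absorbs the terms
  of fuzzy sets that vanish at the base point.\<close>

lemma inf01_mono:
  assumes S: "S \<subseteq> {0..1}"
    and dom: "\<And>t. t \<in> T \<Longrightarrow> 1 \<le> t \<or> (\<exists>s\<in>S. s \<le> t)"
  shows "inf01 S \<le> inf01 T"
proof (rule inf01_ge)
  show le1: "inf01 S \<le> 1"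
    using inf01_in_unit[OF S] by simp
  fix t assume "t \<in> T"
  from dom[OF this] show "inf01 S \<le> t"
    using le1 inf01_le[OF S] by (meson order_trans)
qed

lemma sup01_mono:
  assumes T: "T \<subseteq> {0..1}"
    and dom: "\<And>s. s \<in> S \<Longrightarrow> s \<le> 0 \<or> (\<exists>t\<in>T. s \<le> t)"
  shows "sup01 S \<le> sup01 T"
proof (rule sup01_le)
  show ge0: "0 \<le> sup01 T"
    using sup01_in_unit[OF T] by simp
  fix s assume "s \<in> S"
  from dom[OF this] show "s \<le> sup01 T"
    using ge0 sup01_ge[OF T] by (meson order_trans)
qed

lemma inf01_antimono: "S \<subseteq> {0..1} \<Longrightarrow> T \<subseteq> S \<Longrightarrow> inf01 S \<le> inf01 T"
  by (rule inf01_mono) auto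

lemma sup01_subset_mono: "T \<subseteq> {0..1} \<Longrightarrow> S \<subseteq> T \<Longrightarrow> sup01 S \<le> sup01 T"
  by (rule sup01_mono) auto

section \<open>Overlap functions and their residual implicators\<close>

lemma overlap_in_unit:
  "overlap_function Ov \<Longrightarrow> x \<in> {0..1} \<Longrightarrow> y \<in> {0..1} \<Longrightarrow> Ov x y \<in> {0..1}"
  unfolding overlap_function_def by blast

lemma overlap_mono:
  "overlap_function Ov \<Longrightarrow> x \<in> {0..1} \<Longrightarrow> x' \<in> {0..1} \<Longrightarrow> y \<in> {0..1} \<Longrightarrow> y' \<in> {0..1} \<Longrightarrow>
    x \<le> x' \<Longrightarrow> y \<le> y' \<Longrightarrow> Ov x y \<le> Ov x' y'"
  unfolding overlap_function_def by blast

lemma overlap_eq_0_iff: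
  "overlap_function Ov \<Longrightarrow> x \<in> {0..1} \<Longrightarrow> y \<in> {0..1} \<Longrightarrow> Ov x y = 0 \<longleftrightarrow> x * y = 0"
  unfolding overlap_function_def by blast

text \<open>\<open>GREATEST\<close> says nothing unless a maximum exists; here the admissible
  \<open>z\<close> form a compact set containing 0. Everything later uses the implicator only
  through these three facts.\<close>

lemma R_implicator_is_max:
  assumes Ov: "overlap_function Ov" and x: "x \<in> {0..1}" and y: "y \<in> {0..1}"
  shows "R_implicator Ov x y \<in> {0..1}"
    and "Ov x (R_implicator Ov x y) \<le> y"
    and "\<And>z. z \<in> {0..1} \<Longrightarrow> Ov x z \<le> y \<Longrightarrow> z \<le> R_implicator Ov x y"
proof -
  let ?Z = "{z \<in> {0..1}. Ov x z \<le> y}"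
  have "continuous_on ({0..1} \<times> {0..1}) (\<lambda>(x, y). Ov x y)"
    using Ov unfolding overlap_function_def by blast
  then have "continuous_on {0..1} ((\<lambda>(x, y). Ov x y) \<circ> Pair x)"
    using x by (intro continuous_on_compose continuous_intros)
      (auto elim!: continuous_on_subset)
  then have "continuous_on {0..1} (Ov x)"
    by (simp add: o_def)
  then have "closed ?Z"
    using continuous_on_closed_Collect_le[of "{0..1}" "Ov x" "\<lambda>_. y"] by simp
  moreover have "bounded ?Z"
    by (rule bounded_subset[of "{0..1}"]) auto
  ultimately have "compact ?Z"
    by (simp add: compact_eq_bounded_closed)
  moreover have "Ov x 0 = 0"
    using overlap_eq_0_iff[OF Ov x, of 0] by simp
  then have "0 \<in> ?Z"
    using y by simp
  then have "?Z \<noteq> {}" by blast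
  ultimately obtain m where m: "m \<in> ?Z" "\<forall>z\<in>?Z. z \<le> m"
    using compact_attains_sup by blast
  have "R_implicator Ov x y = m"
    unfolding R_implicator_def using m by (intro Greatest_equality) auto
  with m show "R_implicator Ov x y \<in> {0..1}" "Ov x (R_implicator Ov x y) \<le> y"
    "\<And>z. z \<in> {0..1} \<Longrightarrow> Ov x z \<le> y \<Longrightarrow> z \<le> R_implicator Ov x y"
    by auto
qed

text \<open>Lowering \<open>x\<close> and raising \<open>y\<close> enlarges the set of admissible
  \<open>z\<close>, so the old maximum remains admissible.\<close>

lemma R_implicator_mono:
  assumes Ov: "overlap_function Ov"
    and unit: "x \<in> {0..1}" "x' \<in> {0..1}" "y \<in> {0..1}" "y' \<in> {0..1}"
    and "x' \<le> x" "y \<le> y'"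
  shows "R_implicator Ov x y \<le> R_implicator Ov x' y'"
proof (rule R_implicator_is_max(3)[OF Ov \<open>x' \<in> _\<close> \<open>y' \<in> _\<close>])
  note I = R_implicator_is_max[OF Ov \<open>x \<in> _\<close> \<open>y \<in> _\<close>]
  show "R_implicator Ov x y \<in> {0..1}" by (rule I(1))
  with assms have "Ov x' (R_implicator Ov x y) \<le> Ov x (R_implicator Ov x y)"
    by (intro overlap_mono[OF Ov]) auto
  also have "\<dots> \<le> y'" using I(2) \<open>y \<le> y'\<close> by linarith
  finally show "Ov x' (R_implicator Ov x y) \<le> y'" .
qed

text \<open>Since \<open>Ov 0 1 = 0\<close>, even \<open>z = 1\<close> is admissible. Hence members
  vanishing at \<open>x\<close> cannot lower the infimum in \<open>N1\<close>.\<close>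

lemma R_implicator_0_left:
  assumes Ov: "overlap_function Ov" and y: "y \<in> {0..1}"
  shows "R_implicator Ov 0 y = 1"
proof -
  have "Ov 0 1 = 0"
    using overlap_eq_0_iff[OF Ov, of 0 1] by simp
  then have "1 \<le> R_implicator Ov 0 y"
    using y by (intro R_implicator_is_max(3)[OF Ov]) auto
  then show ?thesis
    using R_implicator_is_max(1)[OF Ov _ y, of 0] by simp
qed

section \<open>Minimal and maximal descriptions at a point\<close>

lemma members_at_mono: "D' \<subseteq> D \<Longrightarrow> members_at D' x \<subseteq> members_at D x"
  by (auto simp: members_at_def)

lemma md_subset: "md D x \<subseteq> D"
  by (auto simp: md_def members_at_def)

lemma MD_subset: "MD D x \<subseteq> D"
  by (auto simp: MD_def members_at_def)

text \<open>\<open>md\<close> compares only members with equal value at \<open>x\<close>, so it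
  suffices to minimise within the finite set of members sharing the value
  \<open>K x\<close>.\<close>

lemma ex_md_below:
  assumes "finite D" "K \<in> D" "0 < K x"
  obtains S where "S \<in> md D x" "S x = K x" "S \<le> K"
proof -
  let ?A = "{S \<in> D. S x = K x}"
  have "finite ?A" "K \<in> ?A" using assms by auto
  from finite_has_minimal2[OF this] obtain S
    where S: "S \<in> ?A" "S \<le> K" "\<forall>T\<in>?A. T \<le> S \<longrightarrow> S = T" by blast
  then have "S \<in> md D x"
    using assms(3) unfolding md_def members_at_def by auto
  with S that show thesis by auto
qed

lemma ex_MD_above:
  assumes "finite D" "K \<in> D" "0 < K x"
  obtains S where "S \<in> MD D x" "S x = K x" "K \<le> S"
proof -
  let ?A = "{S \<in> D. S x = K x}"
  have "finite ?A" "K \<in> ?A" using assms by auto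
  from finite_has_maximal2[OF this] obtain S
    where S: "S \<in> ?A" "K \<le> S" "\<forall>T\<in>?A. S \<le> T \<longrightarrow> S = T" by blast
  then have "S \<in> MD D x"
    using assms(3) unfolding MD_def members_at_def by auto
  with S that show thesis by auto
qed

text \<open>A \<open>K\<close> minimal in \<open>D'\<close> lies above some \<open>S\<close> in
  \<open>md D x\<close> with the same value at \<open>x\<close>. This \<open>S\<close> survives in
  \<open>D'\<close>, so minimality of \<open>K\<close> forces \<open>S = K\<close>.\<close>

lemma md_eq_of_subset:
  assumes "finite D" "D' \<subseteq> D" "md D x \<subseteq> D'"
  shows "md D' x = md D x"
proof (rule equalityI; rule subsetI)
  fix K assume K: "K \<in> md D' x"
  then have mem: "K \<in> D" "0 < K x"
    using \<open>D' \<subseteq> D\<close> by (auto simp: md_def members_at_def)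
  from ex_md_below[OF \<open>finite D\<close> this] obtain S where S: "S \<in> md D x" "S x = K x" "S \<le> K" .
  with K mem \<open>md D x \<subseteq> D'\<close> have "S = K"
    unfolding md_def members_at_def by auto
  with S show "K \<in> md D x" by simp
next
  fix K assume K: "K \<in> md D x"
  with \<open>md D x \<subseteq> D'\<close> have "K \<in> D'" by blast
  with K show "K \<in> md D' x"
    using members_at_mono[OF \<open>D' \<subseteq> D\<close>, of x] unfolding md_def by (auto simp: members_at_def)
qed

lemma MD_eq_of_subset:
  assumes "finite D" "D' \<subseteq> D" "MD D x \<subseteq> D'"
  shows "MD D' x = MD D x"
proof (rule equalityI; rule subsetI)
  fix K assume K: "K \<in> MD D' x"
  then have mem: "K \<in> D" "0 < K x"
    using \<open>D' \<subseteq> D\<close> by (auto simp: MD_def members_at_def)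
  from ex_MD_above[OF \<open>finite D\<close> this] obtain S where S: "S \<in> MD D x" "S x = K x" "K \<le> S" .
  with K mem \<open>MD D x \<subseteq> D'\<close> have "S = K"
    unfolding MD_def members_at_def by auto
  with S show "K \<in> MD D x" by simp
next
  fix K assume K: "K \<in> MD D x"
  with \<open>MD D x \<subseteq> D'\<close> have "K \<in> D'" by blast
  with K show "K \<in> MD D' x"
    using members_at_mono[OF \<open>D' \<subseteq> D\<close>, of x] unfolding MD_def by (auto simp: members_at_def)
qed

section \<open>Intersections and irreducible members\<close>

text \<open>Over a finite non-empty family each pointwise infimum is a minimum; the member realising
  it may change with \<open>x\<close>.\<close>

lemma fuzzy_Inter_attained:
  assumes "finite D" "D \<noteq> {}"
  obtains S where "S \<in> D" "S x = fuzzy_Inter D x" "fuzzy_Inter D \<le> S"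
proof -
  have fin: "finite ((\<lambda>K. K y) ` D)" "(\<lambda>K. K y) ` D \<noteq> {}" for y
    using assms by auto
  have eq: "fuzzy_Inter D y = Min ((\<lambda>K. K y) ` D)" for y
    using fin[of y] by (simp add: fuzzy_Inter_def inf01_def cInf_eq_Min)
  have "fuzzy_Inter D x \<in> (\<lambda>K. K x) ` D"
    unfolding eq using fin by (rule Min_in)
  then obtain S where "S \<in> D" "S x = fuzzy_Inter D x" by auto
  moreover from \<open>S \<in> D\<close> have "fuzzy_Inter D \<le> S"
    unfolding le_fun_def eq using fin(1) by (auto intro: Min_le)
  ultimately show thesis using that by blast
qed

text \<open>If \<open>K\<close> were an intersection of other members, one of them would agree with
  \<open>K\<close> at \<open>x\<close> and lie above it, contradicting \<open>max\<close>.
  Maximality is stated without \<open>MD\<close> so as to cover \<open>K x = 0\<close> too.\<close>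

lemma maximal_in_cov_Int:
  assumes "finite C" "K \<in> C"
    and max: "\<And>S. S \<in> C \<Longrightarrow> S x = K x \<Longrightarrow> K \<le> S \<Longrightarrow> S = K"
  shows "K \<in> cov_Int C"
proof (rule ccontr)
  assume "K \<notin> cov_Int C"
  with \<open>K \<in> C\<close> obtain C' where C': "C' \<noteq> {}" "C' \<subseteq> C - {K}" "K = fuzzy_Inter C'"
    unfolding cov_Int_def by auto
  then have "finite C'"
    using \<open>finite C\<close> by (meson finite_Diff finite_subset)
  from fuzzy_Inter_attained[OF this C'(1), of x] obtain S
    where "S \<in> C'" "S x = K x" "K \<le> S" using C'(3) by metis
  with max C'(2) show False by blast
qed

lemma MD_subset_cov_Int:
  assumes "finite C"
  shows "MD C x \<subseteq> cov_Int C"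
proof
  fix K assume "K \<in> MD C x"
  then show "K \<in> cov_Int C"
    using assms by (intro maximal_in_cov_Int[of C K x]) (auto simp: MD_def members_at_def)
qed

lemma ex_cov_Int_above:
  assumes "finite C" "K \<in> C"
  obtains S where "S \<in> cov_Int C" "S x = K x" "K \<le> S"
proof -
  let ?A = "{S \<in> C. S x = K x}"
  have "finite ?A" "K \<in> ?A" using assms by auto
  from finite_has_maximal2[OF this] obtain S
    where S: "S \<in> ?A" "K \<le> S" "\<forall>T\<in>?A. S \<le> T \<longrightarrow> S = T" by blast
  then have "S \<in> cov_Int C"
    using \<open>finite C\<close> by (intro maximal_in_cov_Int[of C S x]) auto
  with S that show thesis by auto
qed

lemma cov1_subset: "cov1 C \<subseteq> C"
  unfolding cov1_def by (rule UN_least) (rule md_subset)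

lemma cov2_subset: "cov2 C \<subseteq> C"
  unfolding cov2_def by (rule UN_least) (rule MD_subset)

lemma cov_Int_subset: "cov_Int C \<subseteq> C"
  unfolding cov_Int_def by (rule Diff_subset)

section \<open>Comparing operators over a family and a subfamily\<close>

context
  fixes Ov :: "real \<Rightarrow> real \<Rightarrow> real"
  assumes Ov: "overlap_function Ov"
begin

lemma implicator_image_unit:
  assumes "\<forall>K\<in>D. \<forall>x. K x \<in> {0..1}"
  shows "(\<lambda>K. R_implicator Ov (K x) (K y)) ` D \<subseteq> {0..1}"
  using assms by (intro image_subsetI R_implicator_is_max(1)[OF Ov]) simp_all

lemma overlap_image_unit:
  assumes "\<forall>K\<in>D. \<forall>x. K x \<in> {0..1}"
  shows "(\<lambda>K. Ov (K x) (K y)) ` D \<subseteq> {0..1}"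
  using assms by (intro image_subsetI overlap_in_unit[OF Ov]) simp_all

text \<open>\<open>cov3\<close> consists of new fuzzy sets rather than members of \<open>D\<close>,
  so its range in \<open>[0,1]\<close> cannot be inherited by inclusion.\<close>

lemma cov3_in_unit:
  assumes "\<forall>K\<in>D. \<forall>x. K x \<in> {0..1}"
  shows "\<forall>K\<in>cov3 Ov D. \<forall>x. K x \<in> {0..1}"
  using inf01_in_unit[OF implicator_image_unit[OF assms]] by (auto simp: cov3_def N1_def)

lemma cov4_in_unit:
  assumes "\<forall>K\<in>D. \<forall>x. K x \<in> {0..1}"
  shows "\<forall>K\<in>cov4 Ov D. \<forall>x. K x \<in> {0..1}"
  using sup01_in_unit[OF overlap_image_unit[OF assms]] by (auto simp: cov4_def N4_def)

text \<open>This also holds when \<open>MD D x\<close> is empty, because the empty infimum is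
  1.\<close>

lemma N1_le_N3:
  assumes "\<forall>K\<in>D. \<forall>x. K x \<in> {0..1}"
  shows "N1 Ov D \<le> N3 Ov D"
  unfolding le_fun_def N1_def N3_def
  by (intro allI inf01_antimono implicator_image_unit[OF assms] image_mono[OF MD_subset])

lemma N2_le_N4:
  assumes "\<forall>K\<in>D. \<forall>x. K x \<in> {0..1}"
  shows "N2 Ov D \<le> N4 Ov D"
  unfolding le_fun_def N2_def N4_def
  by (intro allI sup01_subset_mono overlap_image_unit[OF assms] image_mono[OF md_subset])

text \<open>The inequalities in \<open>dom\<close> point in opposite directions because the
  implicator is antitone in its first and monotone in its second argument. Members with
  \<open>K x = 0\<close> contribute the harmless value 1.\<close>

lemma N1_eq_of_subset:
  assumes unit: "\<forall>K\<in>D. \<forall>x. K x \<in> {0..1}" and sub: "D' \<subseteq> D"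
    and dom: "\<And>K x y. K \<in> D \<Longrightarrow> 0 < K x \<Longrightarrow> \<exists>S\<in>D'. K x \<le> S x \<and> S y \<le> K y"
  shows "N1 Ov D' = N1 Ov D"
proof (intro ext antisym)
  fix x y
  show "N1 Ov D x y \<le> N1 Ov D' x y"
    unfolding N1_def by (rule inf01_antimono[OF implicator_image_unit[OF unit] image_mono[OF sub]])
  have unit': "\<forall>K\<in>D'. \<forall>x. K x \<in> {0..1}"
    using unit sub by (meson subsetD)
  show "N1 Ov D' x y \<le> N1 Ov D x y"
    unfolding N1_def
  proof (rule inf01_mono[OF implicator_image_unit[OF unit']])
    fix t assume "t \<in> (\<lambda>K. R_implicator Ov (K x) (K y)) ` D"
    then obtain K where K: "K \<in> D" and t: "t = R_implicator Ov (K x) (K y)" by blast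
    show "1 \<le> t \<or> (\<exists>s\<in>(\<lambda>K. R_implicator Ov (K x) (K y)) ` D'. s \<le> t)"
    proof (cases "K x = 0")
      case True
      then show ?thesis
        using R_implicator_0_left[OF Ov] unit K t by simp
    next
      case False
      then have "0 < K x" using unit[rule_format, OF K, of x] by simp
      from dom[OF K this, of y] obtain S where "S \<in> D'" "K x \<le> S x" "S y \<le> K y" by auto
      moreover from this have "R_implicator Ov (S x) (S y) \<le> t"
        unfolding t using unit unit' K by (intro R_implicator_mono[OF Ov]) simp_all
      ultimately show ?thesis by blast
    qed
  qed
qed

text \<open>Both inequalities in \<open>dom\<close> now point upwards, as \<open>Ov\<close> is
  monotone in each argument; members with \<open>K x = 0\<close> contribute 0.\<close>

lemma N4_eq_of_subset:
  assumes unit: "\<forall>K\<in>D. \<forall>x. K x \<in> {0..1}" and sub: "D' \<subseteq> D"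
    and dom: "\<And>K x y. K \<in> D \<Longrightarrow> 0 < K x \<Longrightarrow> \<exists>S\<in>D'. K x \<le> S x \<and> K y \<le> S y"
  shows "N4 Ov D' = N4 Ov D"
proof (intro ext antisym)
  fix x y
  show "N4 Ov D' x y \<le> N4 Ov D x y"
    unfolding N4_def by (rule sup01_subset_mono[OF overlap_image_unit[OF unit] image_mono[OF sub]])
  have unit': "\<forall>K\<in>D'. \<forall>x. K x \<in> {0..1}"
    using unit sub by (meson subsetD)
  show "N4 Ov D x y \<le> N4 Ov D' x y"
    unfolding N4_def
  proof (rule sup01_mono[OF overlap_image_unit[OF unit']])
    fix s assume "s \<in> (\<lambda>K. Ov (K x) (K y)) ` D"
    then obtain K where K: "K \<in> D" and s: "s = Ov (K x) (K y)" by blast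
    show "s \<le> 0 \<or> (\<exists>t\<in>(\<lambda>K. Ov (K x) (K y)) ` D'. s \<le> t)"
    proof (cases "K x = 0")
      case True
      then show ?thesis
        using overlap_eq_0_iff[OF Ov, of 0 "K y"] unit K s by simp
    next
      case False
      then have "0 < K x" using unit[rule_format, OF K, of x] by simp
      from dom[OF K this, of y] obtain S where "S \<in> D'" "K x \<le> S x" "K y \<le> S y" by auto
      moreover from this have "s \<le> Ov (S x) (S y)"
        unfolding s using unit unit' K by (intro overlap_mono[OF Ov]) simp_all
      ultimately show ?thesis by blast
    qed
  qed
qed

section \<open>Invariance under the reductions of a finite family\<close>

context
  fixes C :: "'u fuzzy set"
  assumes fin: "finite C" and unit: "\<forall>K\<in>C. \<forall>x. K x \<in> {0..1}"
begin

lemma N1_cov1: "N1 Ov (cov1 C) = N1 Ov C"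
proof (rule N1_eq_of_subset[OF unit cov1_subset])
  fix K x y assume "K \<in> C" "0 < K x"
  from ex_md_below[OF fin this] obtain S where "S \<in> md C x" "S x = K x" "S \<le> K" .
  then show "\<exists>S\<in>cov1 C. K x \<le> S x \<and> S y \<le> K y"
    unfolding cov1_def le_fun_def by (metis UN_I UNIV_I order_refl)
qed

text \<open>Here the value has to be preserved at the second point, where \<open>K\<close> may vanish.\<close>

lemma N1_cov_Int: "N1 Ov (cov_Int C) = N1 Ov C"
proof (rule N1_eq_of_subset[OF unit cov_Int_subset])
  fix K x y assume "K \<in> C"
  from ex_cov_Int_above[OF fin this, of y] obtain S where "S \<in> cov_Int C" "S y = K y" "K \<le> S" .
  then show "\<exists>S\<in>cov_Int C. K x \<le> S x \<and> S y \<le> K y"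
    unfolding le_fun_def by (metis order_refl)
qed

text \<open>\<open>N2\<close> sees a family only through its sets \<open>md\<close>, and
  \<open>cov1\<close> retains all of them.\<close>

lemma N2_cov1: "N2 Ov (cov1 C) = N2 Ov C"
proof -
  have "md (cov1 C) x = md C x" for x
    using fin cov1_subset by (rule md_eq_of_subset) (auto simp: cov1_def)
  then show ?thesis by (simp add: N2_def fun_eq_iff)
qed

lemma N3_cov2: "N3 Ov (cov2 C) = N3 Ov C"
proof -
  have "MD (cov2 C) x = MD C x" for x
    using fin cov2_subset by (rule MD_eq_of_subset) (auto simp: cov2_def)
  then show ?thesis by (simp add: N3_def fun_eq_iff)
qed

lemma N3_cov_Int: "N3 Ov (cov_Int C) = N3 Ov C"
proof -
  have "MD (cov_Int C) x = MD C x" for x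
    using fin cov_Int_subset MD_subset_cov_Int[OF fin] by (rule MD_eq_of_subset)
  then show ?thesis by (simp add: N3_def fun_eq_iff)
qed

lemma N4_cov2: "N4 Ov (cov2 C) = N4 Ov C"
proof (rule N4_eq_of_subset[OF unit cov2_subset])
  fix K x y assume "K \<in> C" "0 < K x"
  from ex_MD_above[OF fin this] obtain S where "S \<in> MD C x" "K \<le> S" .
  then show "\<exists>S\<in>cov2 C. K x \<le> S x \<and> K y \<le> S y"
    unfolding cov2_def le_fun_def by blast
qed

lemma N4_cov_Int: "N4 Ov (cov_Int C) = N4 Ov C"
proof (rule N4_eq_of_subset[OF unit cov_Int_subset])
  fix K x y assume "K \<in> C"
  \<comment> \<open>Any point of agreement serves, since only \<open>K \<le> S\<close>
    enters.\<close>
  from ex_cov_Int_above[OF fin this] obtain S where "S \<in> cov_Int C" "K \<le> S" .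
  then show "\<exists>S\<in>cov_Int C. K x \<le> S x \<and> K y \<le> S y"
    unfolding le_fun_def by blast
qed

end

end

theorem corollary4p1:
  fixes C :: "'u fuzzy set" and Ov :: "real \<Rightarrow> real \<Rightarrow> real"
  assumes "fuzzy_covering C" and "finite C"
    and "overlap_function Ov" and "overlap_O7 Ov"
  shows
    "(\<forall>P \<in> {group_A1 Ov C, group_A2 Ov C, group_A3 Ov C, group_B Ov C, group_C Ov C,
            group_D Ov C, group_E Ov C, group_F1 Ov C, group_F2 Ov C, group_G Ov C,
            group_H1 Ov C, group_H2 Ov C, group_I Ov C, group_J Ov C, group_K Ov C,
            group_L Ov C, group_M Ov C}. all_equal P) \<and>
     (group_A1 Ov C \<preceq> group_F1 Ov C \<and> group_E Ov C \<preceq> group_H1 Ov C) \<and>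
     (group_A1 Ov C \<preceq> group_B Ov C \<and> group_E Ov C \<preceq> group_L Ov C) \<and>
     (group_F2 Ov C \<preceq> group_F1 Ov C \<and> group_H2 Ov C \<preceq> group_H1 Ov C) \<and>
     (group_A3 Ov C \<preceq> group_C Ov C \<and> group_A2 Ov C \<preceq> group_D Ov C) \<and>
     (group_I Ov C \<preceq> group_K Ov C \<and> group_G Ov C \<preceq> group_J Ov C) \<and>
     (group_M Ov C \<preceq> group_H1 Ov C \<and> group_A1 Ov C \<preceq> group_F1 Ov C)"
proof -
  note Ov = \<open>overlap_function Ov\<close>
  have unit: "\<forall>K\<in>C. \<forall>x. K x \<in> {0..1}"
    using \<open>fuzzy_covering C\<close> unfolding fuzzy_covering_def by blast
  have unit_sub: "\<forall>K\<in>D. \<forall>x. K x \<in> {0..1}" if "D \<subseteq> C" for D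
    using unit that by (meson subsetD)
  note units = unit unit_sub[OF cov1_subset] unit_sub[OF cov2_subset] unit_sub[OF cov_Int_subset]
    cov3_in_unit[OF Ov unit] cov4_in_unit[OF Ov unit]
  \<comment> \<open>As rewrite rules these collapse \<open>A1\<close>, \<open>E\<close>,
    \<open>F1\<close> and \<open>H1\<close>, the only groups listing several operators, to their
    operator over \<open>C\<close>.\<close>
  note eqs [simp] = N1_cov1[OF Ov \<open>finite C\<close> unit] N1_cov_Int[OF Ov \<open>finite C\<close> unit]
    N2_cov1[OF Ov \<open>finite C\<close> unit] N3_cov2[OF Ov \<open>finite C\<close> unit]
    N3_cov_Int[OF Ov \<open>finite C\<close> unit] N4_cov2[OF Ov \<open>finite C\<close> unit]
    N4_cov_Int[OF Ov \<open>finite C\<close> unit]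
  note groups = group_A1_def group_A2_def group_A3_def group_B_def group_C_def group_D_def
    group_E_def group_F1_def group_F2_def group_G_def group_H1_def group_H2_def group_I_def
    group_J_def group_K_def group_L_def group_M_def
  \<comment> \<open>Each of the six families in \<open>units\<close> yields one comparison of each
    kind.\<close>
  note le = units[THEN N1_le_N3[OF Ov]] units[THEN N2_le_N4[OF Ov]]
  show ?thesis
    unfolding groups all_equal_def group_le_def using le by simp
qed

end
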